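(* Let $t\ge 2$ be an integer and consider P\'olya urns with $d=1$. Then $$\mathbf{P}(I_{t-1,1}\ge (t-1)/t)=\mathbf{P}(S_{1,t-1}\le 1/t)=\begin{cases}1-\ln 2 & \text{for } t=2,\\[4pt] \dfrac{(t-1)\big(1-\frac1t\big)^{t-2}-1}{t-2} & \text{for } t>2.\end{cases}$$ In particular, $p_+(t):=\mathbf{P}(I_{t-1,1}\ge (t-1)/t)\longrightarrow e^{-1}$ as $t\to\infty$.
   Context: P\'olya's urn with $d=1$ and integer parameters $r,b\ge 1$: the urn initially contains $r$ red and $b$ black balls. In each draw one ball is taken uniformly at random from the urn, and this ball together with one more ball of the same color is put into the urn. $R_n$ is the number of red balls after the $n$th draw ($R_0=r$), $Z_n=R_n/(n+r+b)$, $S_{r,b}=\sup_{n\ge 0}Z_n$ and $I_{r,b}=\inf_{n\ge 0}Z_n$. *)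

theory Defs
  imports "HOL-Probability.Probability"
begin

text \<open>
  Polya's urn with \<^term>\<open>d = 1\<close> on an arbitrary probability space; \<^term>\<open>R n\<close> is the number of red
  balls after the \<^term>\<open>n\<close>-th draw. After \<^term>\<open>n\<close> draws the urn contains \<^term>\<open>n + r + b\<close> balls, so
  given the history of the urn the next ball drawn is red with probability
  \<^term>\<open>R n / (n + r + b)\<close>. The conditional probability is only constrained for histories of
  positive probability.
\<close>

locale polya_urn = prob_space M for M :: "'a measure" +
  fixes R :: "nat \<Rightarrow> 'a \<Rightarrow> nat" and r b :: nat
  assumes red_pos: "r \<ge> 1"
    and black_pos: "b \<ge> 1"
    and random_variable_R: "random_variable (count_space UNIV) (R n)"
    and initial: "\<omega> \<in> space M \<Longrightarrow> R 0 \<omega> = r"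
    and one_ball_added: "\<omega> \<in> space M \<Longrightarrow> R (Suc n) \<omega> = R n \<omega> \<or> R (Suc n) \<omega> = Suc (R n \<omega>)"
    and draw_red:
      "\<P>(\<omega> in M. \<forall>i\<le>n. R i \<omega> = h i) > 0 \<Longrightarrow>
        \<P>(\<omega> in M. R (Suc n) \<omega> = Suc (h n) \<bar> \<forall>i\<le>n. R i \<omega> = h i) = real (h n) / real (n + r + b)"

definition urn_Z :: "(nat \<Rightarrow> 'a \<Rightarrow> nat) \<Rightarrow> nat \<Rightarrow> nat \<Rightarrow> nat \<Rightarrow> 'a \<Rightarrow> real" where
  "urn_Z R r b n \<omega> = real (R n \<omega>) / real (n + r + b)"

text \<open>
  On the space of a \<^locale>\<open>polya_urn\<close> the fractions lie in \<^term>\<open>{0..1::real}\<close>, so the supremum and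
  infimum below are over bounded sets of reals.
\<close>

definition urn_S :: "(nat \<Rightarrow> 'a \<Rightarrow> nat) \<Rightarrow> nat \<Rightarrow> nat \<Rightarrow> 'a \<Rightarrow> real" where
  "urn_S R r b \<omega> = (SUP n. urn_Z R r b n \<omega>)"

definition urn_I :: "(nat \<Rightarrow> 'a \<Rightarrow> nat) \<Rightarrow> nat \<Rightarrow> nat \<Rightarrow> 'a \<Rightarrow> real" where
  "urn_I R r b \<omega> = (INF n. urn_Z R r b n \<omega>)"

lemma (in polya_urn) urn_Z_bounds:
  assumes "\<omega> \<in> space M"
  shows "0 \<le> urn_Z R r b n \<omega>" "urn_Z R r b n \<omega> \<le> 1"
proof -
  have "R n \<omega> \<le> n + r"
  proof (induction n)
    case (Suc n)
    then show ?case using one_ball_added[OF assms, of n] by auto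
  qed (use initial[OF assms] in simp)
  then show "0 \<le> urn_Z R r b n \<omega>" "urn_Z R r b n \<omega> \<le> 1"
    using red_pos by (auto simp: urn_Z_def divide_simps)
qed

text \<open>
  The locale is inhabited for all \<^term>\<open>r\<close> and \<^term>\<open>b\<close>: before draw \<^term>\<open>Suc n\<close>, number the balls
  from \<^term>\<open>0::nat\<close> to \<^term>\<open>n + r + b - 1\<close> with the red ones first, and draw a uniformly
  distributed number, independently of the earlier draws.
\<close>

fun urn_path :: "nat \<Rightarrow> (nat \<Rightarrow> nat) \<Rightarrow> nat \<Rightarrow> nat" where
  "urn_path r x 0 = r"
| "urn_path r x (Suc n) = urn_path r x n + (if x n < urn_path r x n then 1 else 0)"

definition urn_draws :: "nat \<Rightarrow> nat \<Rightarrow> (nat \<Rightarrow> nat) measure" where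
  "urn_draws r b = (\<Pi>\<^sub>M n\<in>UNIV. measure_pmf (pmf_of_set {..<n + r + b}))"

lemma urn_path_le: "urn_path r x n \<le> n + r"
  by (induction n) auto

lemma urn_path_cong: "(\<And>j. j < n \<Longrightarrow> x j = y j) \<Longrightarrow> urn_path r x n = urn_path r y n"
  by (induction n) auto

lemma measurable_urn_path:
  assumes "{..<n} \<subseteq> K" and sets: "\<And>j. sets (N j) = UNIV"
  shows "(\<lambda>x. urn_path r x n) \<in> measurable (PiM K N) (count_space UNIV)"
  using assms(1)
proof (induction n)
  case (Suc n)
  have "(\<lambda>x. x n) \<in> measurable (PiM K N) (N n)"
    using Suc.prems by (intro measurable_component_singleton) auto
  moreover have "sets (N n) = sets (count_space UNIV)" by (simp add: sets)
  ultimately have [measurable]: "(\<lambda>x. x n) \<in> measurable (PiM K N) (count_space UNIV)"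
    using measurable_cong_sets[OF refl, of "N n" "count_space UNIV" "PiM K N"] by blast
  have [measurable]: "(\<lambda>x. urn_path r x n) \<in> measurable (PiM K N) (count_space UNIV)"
    using Suc by (auto simp: lessThan_Suc)
  have "(\<lambda>x. m + (if x n < m then 1 else 0)) \<in> measurable (PiM K N) (count_space UNIV)" for m :: nat
    by (rule measurable_compose[of "\<lambda>x. x n" _ "count_space UNIV"]) auto
  from measurable_compose_countable[OF this, of "\<lambda>x. urn_path r x n"]
  show ?case by simp
qed simp

lemma polya_urn_exists:
  assumes r: "r \<ge> 1" and b: "b \<ge> 1"
  shows "polya_urn (urn_draws r b) (\<lambda>n x. urn_path r x n) r b"
proof -
  define N where "N = (\<lambda>n. measure_pmf (pmf_of_set {..<n + r + b}))"
  have draws: "urn_draws r b = PiM UNIV N" by (simp add: urn_draws_def N_def)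
  have setsN: "sets (N j) = UNIV" for j by (simp add: N_def)
  have spaceN: "space (N j) = UNIV" for j by (simp add: N_def)
  have probN: "prob_space (N j)" for j by (simp add: N_def measure_pmf.prob_space_axioms)
  interpret prob_space "PiM UNIV N" by (intro prob_space_PiM probN)
  have space: "space (PiM UNIV N) = UNIV" by (simp add: space_PiM spaceN)
  have distr: "distr (PiM UNIV N) (N n) (\<lambda>x. x n) = N n" for n
    by (rule distr_PiM_component) (auto intro: probN)
  have indep: "indep_vars N (\<lambda>n x. x n) UNIV"
    by (subst indep_vars_iff_distr_eq_PiM') (auto simp: distr restrict_UNIV distr_id2)
  show ?thesis
    unfolding draws
  proof unfold_locales
    fix n h
    let ?H = "\<P>(x in PiM UNIV N. \<forall>i\<le>n. urn_path r x i = h i)"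
    assume H: "?H > 0"
    have "h n \<le> n + r + b"
    proof (rule ccontr)
      assume "\<not> h n \<le> n + r + b"
      then have "urn_path r x n \<noteq> h n" for x using urn_path_le[of r x n] by auto
      then have "{x \<in> space (PiM UNIV N). \<forall>i\<le>n. urn_path r x i = h i} = {}" by blast
      with H show False by simp
    qed
    have "measure (N n) {..<h n} = card ({..<n + r + b} \<inter> {..<h n}) / card {..<n + r + b}"
      unfolding N_def using r by (subst measure_pmf_of_set) (auto simp: ac_simps)
    also have "{..<n + r + b} \<inter> {..<h n} = {..<h n}" using \<open>h n \<le> n + r + b\<close> by auto
    finally have red: "measure (N n) {..<h n} = real (h n) / real (n + r + b)" by simp
    define A where "A = {x \<in> space (PiM {..<n} N). \<forall>i\<le>n. urn_path r x i = h i}"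
    define B where "B = {x \<in> space (PiM {n} N). x n < h n}"
    have A: "A \<in> sets (PiM {..<n} N)"
    proof -
      have [measurable]: "(\<lambda>x. urn_path r x i) \<in> measurable (PiM {..<n} N) (count_space UNIV)"
        if "i \<in> {..n}" for i using that by (intro measurable_urn_path) (auto simp: setsN)
      have "A = {x \<in> space (PiM {..<n} N). \<forall>i\<in>{..n}. urn_path r x i = h i}"
        by (auto simp: A_def)
      also have "\<dots> \<in> sets (PiM {..<n} N)"
        by (intro sets.sets_Collect_finite_All') measurable
      finally show ?thesis .
    qed
    have B: "B \<in> sets (PiM {n} N)"
      using measurable_sets[OF measurable_component_singleton[of n "{n}" N], of "{..<h n}"]
      by (auto simp: B_def setsN vimage_def Int_def conj_commute)
    have A_eq: "(\<lambda>x. restrict x {..<n}) -` A \<inter> space (PiM UNIV N)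
        = {x \<in> space (PiM UNIV N). \<forall>i\<le>n. urn_path r x i = h i}"
    proof -
      have "urn_path r (restrict x {..<n}) i = urn_path r x i" if "i \<le> n" for x i
        using that by (intro urn_path_cong) auto
      then show ?thesis by (auto simp: A_def space_PiM spaceN)
    qed
    have B_eq: "(\<lambda>x. restrict x {n}) -` B \<inter> space (PiM UNIV N)
        = (\<lambda>x. x n) -` {..<h n} \<inter> space (PiM UNIV N)"
      by (auto simp: B_def space_PiM spaceN)
    have "indep_var (PiM {..<n} N) (\<lambda>x. restrict (\<lambda>i. x i) {..<n})
                    (PiM {n} N) (\<lambda>x. restrict (\<lambda>i. x i) {n})"
      by (rule indep_var_restrict[OF indep]) auto
    from indep_varD[OF this A B]
    have "prob ((\<lambda>x. (restrict x {..<n}, restrict x {n})) -` (A \<times> B) \<inter> space (PiM UNIV N)) =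
        ?H * prob ((\<lambda>x. x n) -` {..<h n} \<inter> space (PiM UNIV N))"
      by (simp add: A_eq B_eq)
    also have "prob ((\<lambda>x. x n) -` {..<h n} \<inter> space (PiM UNIV N)) = measure (N n) {..<h n}"
      using measure_distr[of "\<lambda>x. x n" "PiM UNIV N" "N n" "{..<h n}"]
      by (simp add: distr setsN measurable_component_singleton)
    also have "(\<lambda>x. (restrict x {..<n}, restrict x {n})) -` (A \<times> B) \<inter> space (PiM UNIV N)
        = ((\<lambda>x. restrict x {..<n}) -` A \<inter> space (PiM UNIV N)) \<inter>
          ((\<lambda>x. restrict x {n}) -` B \<inter> space (PiM UNIV N))" by auto
    also have "\<dots> = {x \<in> space (PiM UNIV N). urn_path r x (Suc n) = Suc (h n) \<and>
                      (\<forall>i\<le>n. urn_path r x i = h i)}"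
    proof -
      have "urn_path r x (Suc n) = Suc (h n) \<longleftrightarrow> x n < h n" if "urn_path r x n = h n" for x
        using that by simp
      then show ?thesis unfolding A_eq B_eq by blast
    qed
    finally show "\<P>(x in PiM UNIV N. urn_path r x (Suc n) = Suc (h n) \<bar> \<forall>i\<le>n. urn_path r x i = h i)
        = real (h n) / real (n + r + b)"
      using H red by (simp add: cond_prob_def)
  next
    show "(\<lambda>x. urn_path r x n) \<in> measurable (PiM UNIV N) (count_space UNIV)" for n
      by (rule measurable_urn_path) (simp_all add: setsN)
  qed (use r b in simp_all)
qed

end

theory Submission
  imports Defs "HOL-Real_Asymp.Real_Asymp"
begin

text \<open>
  Exchanging the colours turns the infimum of the red fraction into one minus the supremum of the
  black fraction, so both probabilities concern an urn that starts with one red and \<open>t - 1\<close> black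
  balls, and they ask that \<open>t R\<^sub>n \<le> n + t\<close> for all \<open>n\<close>. In terms of the number \<open>k = R\<^sub>n - 1\<close> of red
  draws, the walk \<open>n - t k\<close>, which rises by 1 at a black draw and falls by \<open>t - 1\<close> at a red one, must
  never become negative.

  Such a walk is counted by the ballot theorem: \<open>(n + 1 - t k) / (n + 1) * (n + 1 choose k)\<close> of its
  paths with \<open>k\<close> red draws among \<open>n\<close> stay non-negative. Draws from the urn are exchangeable, and each
  of these paths has the same probability
  \<open>(t - 1) k! (n - k + t - 2)! / (n + t - 1)!\<close>. The product of the two numbers is the probability of
  having survived \<open>n\<close> draws in state \<open>k\<close>. Once this formula is known, no path has to be counted: it
  satisfies the recursion that is given by the transition probabilities of the urn, and it vanishes
  on the boundary \<open>t k = n + 1\<close>, where the walk has just died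
  (\<open>ballot_prob_Suc_Suc\<close>, \<open>prob_survival_state\<close>).

  Summing over \<open>k\<close> gives the probability of surviving \<open>n\<close> draws. The terms are differences of ratios
  of factorials, so for \<open>n + 1 = t N\<close> the sum telescopes (\<open>sum_ballot_prob\<close>); for \<open>t = 2\<close> it is a
  difference of harmonic numbers instead (\<open>sum_ballot_prob_0\<close>), which is where the logarithm comes
  from. Letting \<open>N\<close> tend to infinity yields the probability of surviving forever, and the limit in
  \<open>t\<close> is then elementary because \<open>(1 - 1/t)\<^sup>t\<close> tends to \<open>1/e\<close>.

  Below, \<open>s\<close> stands for \<open>t - 2\<close>, so that no subtraction of natural numbers occurs in the parameter.
\<close>

section \<open>The urn as a Markov chain\<close>

lemma (in polya_urn) R_bounds:
  assumes "\<omega> \<in> space M"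
  shows "r \<le> R n \<omega>" "R n \<omega> \<le> n + r"
proof (induction n)
  case (Suc n)
  { case 1 then show ?case using Suc one_ball_added[OF assms, of n] by auto }
  { case 2 then show ?case using Suc one_ball_added[OF assms, of n] by auto }
qed (use initial[OF assms] in simp_all)

lemma (in polya_urn) prob_history_red:
  "\<P>(\<omega> in M. (\<forall>i\<le>n. R i \<omega> = h i) \<and> R (Suc n) \<omega> = Suc (h n)) =
    \<P>(\<omega> in M. \<forall>i\<le>n. R i \<omega> = h i) * (real (h n) / real (n + r + b))"
proof -
  note random_variable_R[measurable]
  have le: "\<P>(\<omega> in M. (\<forall>i\<le>n. R i \<omega> = h i) \<and> R (Suc n) \<omega> = Suc (h n)) \<le>
    \<P>(\<omega> in M. \<forall>i\<le>n. R i \<omega> = h i)"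
    by (rule finite_measure_mono) auto
  show ?thesis
  proof (cases "\<P>(\<omega> in M. \<forall>i\<le>n. R i \<omega> = h i) > 0")
    case True
    from draw_red[OF this] True show ?thesis
      by (simp add: cond_prob_def field_simps conj_commute)
  next
    case False
    then have "\<P>(\<omega> in M. \<forall>i\<le>n. R i \<omega> = h i) = 0"
      by (simp add: zero_less_measure_iff)
    with le show ?thesis
      by (metis (no_types, lifting) measure_nonneg mult_eq_0_iff order_antisym)
  qed
qed

text \<open>
  The Markov property. The event on the right is a finite disjoint union of complete histories, and
  on each of them the conditional probability of a red draw is the same, since it depends on the
  history only through its last value \<open>k\<close>.
\<close>

lemma (in polya_urn) prob_red_step:
  "\<P>(\<omega> in M. (\<forall>i\<le>n. R i \<omega> \<in> A i) \<and> R n \<omega> = k \<and> R (Suc n) \<omega> = Suc k) =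
    \<P>(\<omega> in M. (\<forall>i\<le>n. R i \<omega> \<in> A i) \<and> R n \<omega> = k) * (real k / real (n + r + b))"
proof -
  note random_variable_R[measurable]
  define F where "F = {h \<in> PiE {..n} (\<lambda>i. A i \<inter> {..n + r}). h n = k}"
  define H where "H h = {\<omega> \<in> space M. \<forall>i\<le>n. R i \<omega> = h i}" for h :: "nat \<Rightarrow> nat"
  define H' where "H' h = {\<omega> \<in> space M. (\<forall>i\<le>n. R i \<omega> = h i) \<and> R (Suc n) \<omega> = Suc (h n)}"
    for h :: "nat \<Rightarrow> nat"
  have fin: "finite F"
    unfolding F_def by (rule finite_subset[of _ "PiE {..n} (\<lambda>i. A i \<inter> {..n + r})"])
      (auto intro!: finite_PiE)
  have meas: "H h \<in> sets M" "H' h \<in> sets M" for h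
    unfolding H_def H'_def by measurable
  have hist: "\<exists>h\<in>F. \<omega> \<in> H h"
    if "\<omega> \<in> space M" "\<forall>i\<le>n. R i \<omega> \<in> A i" "R n \<omega> = k" for \<omega>
  proof
    have "R i \<omega> \<le> n + r" if "i \<le> n" for i
      using R_bounds(2)[OF \<open>\<omega> \<in> space M\<close>, of i] that by simp
    with that show "restrict (\<lambda>i. R i \<omega>) {..n} \<in> F" by (auto simp: F_def)
    show "\<omega> \<in> H (restrict (\<lambda>i. R i \<omega>) {..n})" using that by (auto simp: H_def)
  qed
  have F_A: "h i \<in> A i" if "h \<in> F" "i \<le> n" for h i
    using that by (auto simp: F_def PiE_iff)
  have F_n: "h n = k" if "h \<in> F" for h
    using that by (simp add: F_def)
  have disj: "disjoint_family_on H F"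
  proof (unfold disjoint_family_on_def, intro ballI impI)
    fix g h assume gh: "g \<in> F" "h \<in> F" "g \<noteq> h"
    then obtain i where "i \<le> n" "g i \<noteq> h i"
      unfolding F_def by (metis (no_types, lifting) PiE_ext atMost_iff mem_Collect_eq)
    then show "H g \<inter> H h = {}" by (auto simp: H_def)
  qed
  have disj': "disjoint_family_on H' F"
    by (rule disjoint_family_on_bisimulation[OF disj]) (auto simp: H_def H'_def)
  have 1: "{\<omega> \<in> space M. (\<forall>i\<le>n. R i \<omega> \<in> A i) \<and> R n \<omega> = k} = (\<Union>h\<in>F. H h)"
    (is "?L = _")
  proof (intro equalityI subsetI)
    fix \<omega> assume "\<omega> \<in> ?L" then show "\<omega> \<in> (\<Union>h\<in>F. H h)" using hist[of \<omega>] by auto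
  next
    fix \<omega> assume "\<omega> \<in> (\<Union>h\<in>F. H h)" then show "\<omega> \<in> ?L" using F_A F_n by (auto simp: H_def)
  qed
  have "{\<omega> \<in> space M. (\<forall>i\<le>n. R i \<omega> \<in> A i) \<and> R n \<omega> = k \<and> R (Suc n) \<omega> = Suc k} =
      (\<Union>h\<in>F. H h) \<inter> {\<omega> \<in> space M. R (Suc n) \<omega> = Suc k}"
    unfolding 1[symmetric] by auto
  also have "\<dots> = (\<Union>h\<in>F. H' h)"
    using F_n by (fastforce simp: H_def H'_def)
  finally have "\<P>(\<omega> in M. (\<forall>i\<le>n. R i \<omega> \<in> A i) \<and> R n \<omega> = k \<and> R (Suc n) \<omega> = Suc k) =
      prob (\<Union>h\<in>F. H' h)" by simp
  also have "\<dots> = (\<Sum>h\<in>F. prob (H' h))"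
    using meas by (intro finite_measure_finite_Union fin disj') auto
  also have "\<dots> = (\<Sum>h\<in>F. prob (H h) * (real k / real (n + r + b)))"
  proof (rule sum.cong)
    fix h assume "h \<in> F"
    then show "prob (H' h) = prob (H h) * (real k / real (n + r + b))"
      using prob_history_red[of n h] F_n[of h] by (simp add: H_def H'_def)
  qed simp
  also have "\<dots> = (\<Sum>h\<in>F. prob (H h)) * (real k / real (n + r + b))"
    by (rule sum_distrib_right[symmetric])
  also have "(\<Sum>h\<in>F. prob (H h)) = prob (\<Union>h\<in>F. H h)"
    using meas by (intro finite_measure_finite_Union[symmetric] fin disj) auto
  finally show ?thesis by (simp only: 1)
qed

lemma (in polya_urn) prob_black_step:
  "\<P>(\<omega> in M. (\<forall>i\<le>n. R i \<omega> \<in> A i) \<and> R n \<omega> = k \<and> R (Suc n) \<omega> = k) =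
    \<P>(\<omega> in M. (\<forall>i\<le>n. R i \<omega> \<in> A i) \<and> R n \<omega> = k) * (1 - real k / real (n + r + b))"
proof -
  note random_variable_R[measurable]
  let ?E = "{\<omega> \<in> space M. (\<forall>i\<le>n. R i \<omega> \<in> A i) \<and> R n \<omega> = k}"
  let ?r = "{\<omega> \<in> space M. (\<forall>i\<le>n. R i \<omega> \<in> A i) \<and> R n \<omega> = k \<and> R (Suc n) \<omega> = Suc k}"
  have "{\<omega> \<in> space M. (\<forall>i\<le>n. R i \<omega> \<in> A i) \<and> R n \<omega> = k \<and> R (Suc n) \<omega> = k} = ?E - ?r"
    using one_ball_added[of _ n] by auto
  then have "\<P>(\<omega> in M. (\<forall>i\<le>n. R i \<omega> \<in> A i) \<and> R n \<omega> = k \<and> R (Suc n) \<omega> = k) = prob ?E - prob ?r"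
    by (simp only:, intro finite_measure_Diff) auto
  then show ?thesis by (simp add: prob_red_step right_diff_distrib)
qed

text \<open>
  The history of the black balls determines that of the red ones, and a black draw is the complement
  of a red one; hence the black balls form an urn process with the two initial numbers exchanged.
\<close>

lemma (in polya_urn) swap_colours: "polya_urn M (\<lambda>n \<omega>. n + r + b - R n \<omega>) b r"
proof (rule polya_urn.intro[OF prob_space_axioms], unfold_locales)
  note random_variable_R[measurable]
  show "b \<ge> 1" "r \<ge> 1" by (fact black_pos red_pos)+
  show "(\<lambda>\<omega>. n + r + b - R n \<omega>) \<in> measurable M (count_space UNIV)" for n
    by measurable
  show "0 + r + b - R 0 \<omega> = b" if "\<omega> \<in> space M" for \<omega>
    using initial[OF that] by simp
  show "Suc n + r + b - R (Suc n) \<omega> = n + r + b - R n \<omega> \<or>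
      Suc n + r + b - R (Suc n) \<omega> = Suc (n + r + b - R n \<omega>)" if "\<omega> \<in> space M" for \<omega> n
    using one_ball_added[OF that, of n] R_bounds(2)[OF that, of n] by auto
  fix n h
  assume pos: "\<P>(\<omega> in M. \<forall>i\<le>n. i + r + b - R i \<omega> = h i) > 0"
  let ?g = "\<lambda>i. i + r + b - h i"
  have "{\<omega> \<in> space M. \<forall>i\<le>n. i + r + b - R i \<omega> = h i} \<noteq> {}"
    using pos by (metis (lifting) less_irrefl measure_empty)
  then obtain \<omega>0 where \<omega>0: "\<omega>0 \<in> space M" "\<And>i. i \<le> n \<Longrightarrow> i + r + b - R i \<omega>0 = h i" by auto
  then have h: "h i \<le> i + r + b" if "i \<le> n" for i using that by (metis diff_le_self)
  have iff: "i + r + b - R i \<omega> = h i \<longleftrightarrow> R i \<omega> = ?g i" if "\<omega> \<in> space M" "i \<le> n" for \<omega> i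
    using h[OF that(2)] R_bounds(2)[OF that(1), of i] by auto
  have hist: "{\<omega> \<in> space M. \<forall>i\<le>n. i + r + b - R i \<omega> = h i} = {\<omega> \<in> space M. \<forall>i\<le>n. R i \<omega> = ?g i}"
    using iff by auto
  have hist_n: "{\<omega> \<in> space M. \<forall>i\<le>n. R i \<omega> = ?g i} =
      {\<omega> \<in> space M. (\<forall>i\<le>n. R i \<omega> \<in> {?g i}) \<and> R n \<omega> = ?g n}" by auto
  have draw: "{\<omega> \<in> space M. Suc n + r + b - R (Suc n) \<omega> = Suc (h n) \<and>
        (\<forall>i\<le>n. i + r + b - R i \<omega> = h i)} =
      {\<omega> \<in> space M. (\<forall>i\<le>n. R i \<omega> \<in> {?g i}) \<and> R n \<omega> = ?g n \<and> R (Suc n) \<omega> = ?g n}"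
    (is "?L = ?R")
  proof -
    have "Suc n + r + b - R (Suc n) \<omega> = Suc (h n) \<longleftrightarrow> R (Suc n) \<omega> = ?g n" if "\<omega> \<in> space M" for \<omega>
      using h[of n] R_bounds(2)[OF that, of "Suc n"] by auto
    then show ?thesis using iff by auto
  qed
  have "?g n / real (n + r + b) = 1 - h n / real (n + r + b)"
    using h[of n] red_pos by (simp add: of_nat_diff field_simps)
  then have "prob ?L = \<P>(\<omega> in M. \<forall>i\<le>n. i + r + b - R i \<omega> = h i) * (real (h n) / real (n + r + b))"
    unfolding draw prob_black_step hist hist_n by simp
  then show "\<P>(\<omega> in M. Suc n + r + b - R (Suc n) \<omega> = Suc (h n) \<bar> \<forall>i\<le>n. i + r + b - R i \<omega> = h i) =
      real (h n) / real (n + b + r)"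
    using pos by (simp add: cond_prob_def ac_simps)
qed

section \<open>The ballot formula\<close>

text \<open>
  With \<open>t = s + 2\<close> this is the ballot number \<open>(n + 1 - t k) / (n + 1) * (n + 1 choose k)\<close> times the
  probability \<open>(s + 1) k! (n - k + s)! / (n + s + 1)!\<close> of a single path with \<open>k\<close> red draws among \<open>n\<close>
  in the urn with one red and \<open>s + 1\<close> black balls; \<open>k!\<close> and one factor \<open>n + 1\<close> are cancelled.
\<close>

definition ballot_prob :: "nat \<Rightarrow> nat \<Rightarrow> nat \<Rightarrow> real" where
  "ballot_prob s n k = (real n + 1 - (real s + 2) * real k) * (real s + 1) *
     (fact n * fact (n - k + s)) / (fact (n + 1 - k) * fact (n + s + 1))"

lemma ballot_prob_boundary: "(s + 2) * k = n + 1 \<Longrightarrow> ballot_prob s n k = 0"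
proof -
  assume "(s + 2) * k = n + 1"
  then have "real ((s + 2) * k) = real (n + 1)" by (simp only:)
  then show ?thesis by (simp add: ballot_prob_def algebra_simps)
qed

lemma ballot_prob_Suc_0:
  "ballot_prob s (Suc n) 0 = ballot_prob s n 0 * (1 - 1 / (real n + real s + 2))"
proof -
  have "1 - 1 / (real n + real s + 2) = (real n + real s + 1) / (real n + real s + 2)"
    by (simp add: field_simps)
  then show ?thesis
    by (simp add: ballot_prob_def divide_simps del: of_nat_Suc) (simp add: algebra_simps)
qed

text \<open>
  The forward equation of the urn: with \<open>k + 1\<close> red draws among \<open>n + 1\<close>, either the last draw was
  black, when \<open>k + 2\<close> of the \<open>n + s + 2\<close> balls were red, or it was red, when \<open>k + 1\<close> of them were.
  Without the common factor of ratios of factorials it is the polynomial identity \<open>key\<close> in the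
  proof.
\<close>

lemma ballot_prob_Suc_Suc:
  assumes "Suc k \<le> n"
  shows "ballot_prob s (Suc n) (Suc k) =
    ballot_prob s n (Suc k) * (1 - (real k + 2) / (real n + real s + 2)) +
    ballot_prob s n k * ((real k + 1) / (real n + real s + 2))"
proof -
  obtain m where n: "n = Suc k + m" using assms le_Suc_ex by blast
  define X :: real where "X = fact n * fact (m + s) / (fact m * fact (n + s + 1)) * (real s + 1)"
  define d p q w A B where defs: "d = real n + real s + 2"
    "p = real m + 1" "q = real m + 2" "w = real m + real s + 1"
    "A = real n + 1 - (real s + 2) * (real k + 1)" "B = real n + 1 - (real s + 2) * real k"
  have nz: "d \<noteq> 0" "p \<noteq> 0" "q \<noteq> 0" by (auto simp: defs)
  have 1: "ballot_prob s (Suc n) (Suc k) = X * w * ((A + 1) * (real n + 1)) / (q * p * d)"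
    by (simp add: ballot_prob_def n X_def defs field_simps)
  have 2: "ballot_prob s n (Suc k) = X * A / p"
    by (simp add: ballot_prob_def n X_def defs field_simps)
  have 3: "ballot_prob s n k = X * w * B / (q * p)"
    by (simp add: ballot_prob_def n X_def defs field_simps)
  have key: "(A + 1) * (real n + 1) = A * q + B * (real k + 1)"
    by (simp add: n defs algebra_simps)
  have black: "1 - (real k + 2) / d = w / d" by (simp add: n defs field_simps)
  have "X * A / p * (w / d) + X * w * B / (q * p) * (c / d) = X * w * (A * q + B * c) / (q * p * d)"
    for c using nz by (simp add: field_simps)
  then show ?thesis unfolding defs(1)[symmetric] 1 2 3 key black by simp
qed

section \<open>The probability of surviving finitely many draws\<close>

text \<open>
  The red fraction is at most \<open>1 / (s + 2)\<close> up to draw \<open>n\<close>.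
\<close>

definition survival :: "(nat \<Rightarrow> 'a \<Rightarrow> nat) \<Rightarrow> nat \<Rightarrow> nat \<Rightarrow> 'a \<Rightarrow> bool" where
  "survival R s n \<omega> \<longleftrightarrow> (\<forall>i\<le>n. (s + 2) * R i \<omega> \<le> i + s + 2)"

text \<open>
  The range of \<open>k\<close> includes the boundary \<open>(s + 2) * k = n + 1\<close>, where both sides are zero. This is
  what makes the induction work: a state that is alive after draw \<open>n + 1\<close> may have as its black
  predecessor a state that is dead after draw \<open>n\<close>, and that state lies on the boundary.
\<close>

lemma prob_survival_state:
  assumes urn: "polya_urn M R 1 (Suc s)" and k: "(s + 2) * k \<le> n + 1"
  shows "\<P>(\<omega> in M. survival R s n \<omega> \<and> R n \<omega> = Suc k) = ballot_prob s n k"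
  using k
proof (induction n arbitrary: k)
  interpret polya_urn M R 1 "Suc s" by (fact urn)
  case 0
  then have "k = 0" by (cases k) auto
  moreover have "{\<omega> \<in> space M. survival R s 0 \<omega> \<and> R 0 \<omega> = Suc 0} = space M"
    using initial by (auto simp: survival_def)
  ultimately show ?case
    by (simp add: prob_space ballot_prob_def)
next
  interpret polya_urn M R 1 "Suc s" by (fact urn)
  note random_variable_R[measurable]
  case (Suc n)
  define A where "A i = {j. (s + 2) * j \<le> i + s + 2}" for i
  have surv: "survival R s n \<omega> \<longleftrightarrow> (\<forall>i\<le>n. R i \<omega> \<in> A i)" for n \<omega>
    by (simp add: survival_def A_def)
  show ?case
  proof (cases "(s + 2) * k = Suc n + 1")
    case True
    then have "\<not> (s + 2) * Suc k \<le> Suc n + s + 2" by simp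
    then have "{\<omega> \<in> space M. survival R s (Suc n) \<omega> \<and> R (Suc n) \<omega> = Suc k} = {}"
      by (auto simp: survival_def)
    then show ?thesis by (simp only: ballot_prob_boundary[OF True] measure_empty)
  next
    case False
    with Suc.prems have k: "(s + 2) * k \<le> n + 1" by simp
    then have kA: "Suc k \<in> A (Suc n)" by (simp add: A_def)
    have "2 * k \<le> (s + 2) * k" by simp
    with k have "2 * k \<le> n + 1" by linarith
    then have kn: "k \<le> n" by linarith
    have tot: "real (n + 1 + Suc s) = real n + real s + 2" by simp
    let ?same = "{\<omega> \<in> space M. (\<forall>i\<le>n. R i \<omega> \<in> A i) \<and> R n \<omega> = Suc k \<and> R (Suc n) \<omega> = Suc k}"
    let ?up = "{\<omega> \<in> space M. (\<forall>i\<le>n. R i \<omega> \<in> A i) \<and> R n \<omega> = k \<and> R (Suc n) \<omega> = Suc k}"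
    have "R n \<omega> = Suc k \<or> R n \<omega> = k" if "\<omega> \<in> space M" "R (Suc n) \<omega> = Suc k" for \<omega>
      using one_ball_added[OF that(1), of n] that(2) by auto
    then have "{\<omega> \<in> space M. survival R s (Suc n) \<omega> \<and> R (Suc n) \<omega> = Suc k} = ?same \<union> ?up"
      using kA by (auto simp: surv le_Suc_eq)
    then have "\<P>(\<omega> in M. survival R s (Suc n) \<omega> \<and> R (Suc n) \<omega> = Suc k) = prob (?same \<union> ?up)"
      by simp
    also have "\<dots> = prob ?same + prob ?up"
      by (rule finite_measure_Union) auto
    finally have split: "\<P>(\<omega> in M. survival R s (Suc n) \<omega> \<and> R (Suc n) \<omega> = Suc k) =
      prob ?same + prob ?up" .
    have same: "prob ?same = ballot_prob s n k * (1 - real (Suc k) / (real n + real s + 2))"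
      unfolding prob_black_step[of n A "Suc k"] tot Suc.IH[OF k, unfolded surv] ..
    show ?thesis
    proof (cases k)
      case 0
      have "prob ?up = 0" unfolding prob_red_step[of n A k] by (simp add: 0)
      then show ?thesis unfolding split same by (simp add: 0 ballot_prob_Suc_0)
    next
      case (Suc j)
      have "(s + 2) * j \<le> n + 1" using k by (simp add: Suc)
      note IH = Suc.IH[OF this, unfolded surv]
      have up: "prob ?up = ballot_prob s n j * (real (Suc j) / (real n + real s + 2))"
        unfolding Suc prob_red_step[of n A "Suc j"] tot IH ..
      from kn show ?thesis unfolding split same up by (simp add: Suc ballot_prob_Suc_Suc add_ac)
    qed
  qed
qed

text \<open>
  A survivor after \<open>n\<close> draws has \<open>(s + 2) * k \<le> n\<close>; for \<open>n + 1 = (s + 2) * N\<close> this means \<open>k < N\<close>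
  exactly.
\<close>

lemma prob_survival:
  assumes urn: "polya_urn M R 1 (Suc s)" and n: "n + 1 = (s + 2) * N"
  shows "\<P>(\<omega> in M. survival R s n \<omega>) = (\<Sum>k<N. ballot_prob s n k)"
proof -
  interpret polya_urn M R 1 "Suc s" by (fact urn)
  note random_variable_R[measurable]
  have [measurable]: "Measurable.pred M (survival R s n)"
    unfolding survival_def by measurable
  let ?E = "\<lambda>k. {\<omega> \<in> space M. survival R s n \<omega> \<and> R n \<omega> = Suc k}"
  have meas: "?E k \<in> sets M" for k by measurable
  have "{\<omega> \<in> space M. survival R s n \<omega>} = (\<Union>k<N. ?E k)"
  proof -
    have "\<exists>k<N. R n \<omega> = Suc k" if \<omega>: "\<omega> \<in> space M" "survival R s n \<omega>" for \<omega>
    proof -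
      obtain k where k: "R n \<omega> = Suc k"
        using R_bounds(1)[OF \<omega>(1), of n] by (cases "R n \<omega>") auto
      have "(s + 2) * R n \<omega> \<le> n + s + 2" using \<omega>(2) by (simp add: survival_def)
      then have "(s + 2) * k < (s + 2) * N" using n by (simp add: k)
      then have "k < N" using mult_less_cancel1 by blast
      with k show ?thesis by blast
    qed
    then show ?thesis by auto
  qed
  then have "\<P>(\<omega> in M. survival R s n \<omega>) = prob (\<Union>k<N. ?E k)" by simp
  also have "\<dots> = (\<Sum>k<N. prob (?E k))"
    using meas by (intro finite_measure_finite_Union) (auto simp: disjoint_family_on_def)
  also have "\<dots> = (\<Sum>k<N. ballot_prob s n k)"
  proof (rule sum.cong)
    fix k assume "k \<in> {..<N}"
    then have "(s + 2) * k \<le> (s + 2) * N" by (intro mult_le_mono2) simp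
    then show "prob (?E k) = ballot_prob s n k" using n by (intro prob_survival_state urn) simp
  qed simp
  finally show ?thesis .
qed

section \<open>Summation over the states\<close>

lemma fact_add_prod: "fact (m + s) = (fact m * (\<Prod>i<s. real m + 1 + real i) :: real)"
  by (induction s) (simp_all add: algebra_simps)

text \<open>
  In terms of \<open>m = n + 1 - k\<close> the linear factor of the ballot formula is
  \<open>(s + 2) m - (s + 1) (n + 1)\<close>. It remains to sum \<open>(m + s - 1)! / (m - 1)!\<close> and
  \<open>(m + s - 1)! / m!\<close> over \<open>m\<close>; these are products of consecutive integers, \<open>s\<close> of them in the first
  and \<open>s - 1\<close> in the second, whose antidifferences are \<open>(m + s)! / (m - 1)! / (s + 1)\<close> and
  \<open>(m + s)! / m! / s\<close>. The second one requires \<open>s > 0\<close>.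
\<close>

lemma sum_ballot_prob:
  assumes s: "s \<ge> 1" and n: "n + 1 = (s + 2) * N"
  shows "(\<Sum>k<N. ballot_prob s n k) = ((real s + 1) *
    (\<Prod>i<s. ((real s + 1) * real N + 1 + real i) / ((real s + 2) * real N + 1 + real i)) - 1) / real s"
proof -
  \<comment> \<open>\<open>g\<close> is the sum of the two antidifferences with their coefficients, which include the factor \<open>(s + 1) F\<close>.\<close>
  define F :: real where "F = fact n / fact (n + s + 1)"
  define c where "c = (real s + 1)\<^sup>2 / real s * (real n + 1)"
  define g where "g k = F * (fact (n + 1 - k + s) / fact (n + 1 - k)) *
    ((real s + 2) * real (n + 1 - k) - c)" for k
  have tele: "ballot_prob s n k = g k - g (Suc k)" if kn: "k \<le> n" for k
  proof -
    obtain p where p: "n = k + p" using kn le_Suc_ex by blast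
    have sc: "real s * c = (real s + 1)\<^sup>2 * (real n + 1)" using s by (simp add: c_def)
    define Y :: real where "Y = F * fact (p + s) / fact p"
    define u where "u = real p + 1"
    have u: "u \<noteq> 0" by (simp add: u_def)
    have b: "ballot_prob s n k = Y * ((real n + 1 - (real s + 2) * real k) * (real s + 1)) / u"
      by (simp add: ballot_prob_def p Y_def F_def u_def field_simps)
    have g1: "g k = Y * (u + real s) / u * ((real s + 2) * u - c)"
      by (simp add: g_def p Y_def u_def field_simps)
    have g2: "g (Suc k) = Y * ((real s + 2) * (u - 1) - c)"
      by (simp add: g_def p Y_def u_def field_simps)
    have "(u + real s) * ((real s + 2) * u - c) - u * ((real s + 2) * (u - 1) - c) =
        (real s + 2) * u * (real s + 1) - real s * c"
      by (simp add: algebra_simps)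
    also have "\<dots> = (real n + 1 - (real s + 2) * real k) * (real s + 1)"
      unfolding sc by (simp add: p u_def power2_eq_square algebra_simps)
    finally have num: "(u + real s) * ((real s + 2) * u - c) - u * ((real s + 2) * (u - 1) - c) =
        (real n + 1 - (real s + 2) * real k) * (real s + 1)" .
    have "Y * (u + real s) / u * v - Y * w = Y * ((u + real s) * v - u * w) / u" for v w
      using u by (simp add: field_simps)
    then show ?thesis unfolding b g1 g2 num[symmetric] by (rule sym)
  qed
  have rn: "real n + 1 = (real s + 2) * real N"
  proof -
    have "real (n + 1) = real ((s + 2) * N)" by (simp only: n)
    then show ?thesis by (simp add: algebra_simps)
  qed
  have N: "N \<le> n"
  proof -
    have "N \<noteq> 0" using n by (cases N) auto
    moreover have "2 * N \<le> (s + 2) * N" by simp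
    ultimately show ?thesis using n by linarith
  qed
  have "(\<Sum>k<N. ballot_prob s n k) = (\<Sum>k<N. g k - g (Suc k))"
    using N by (intro sum.cong tele) auto
  also have "\<dots> = g 0 - g N" by (rule sum_lessThan_telescope')
  also have "g 0 = - 1 / real s"
  proof -
    have "fact (n + 1 + s) = (fact (n + s + 1) :: real)" by (simp add: add_ac)
    moreover have "fact (n + 1) = (real n + 1) * fact n" by simp
    ultimately have F0: "F * (fact (n + 1 - 0 + s) / fact (n + 1 - 0)) = 1 / (real n + 1)"
      unfolding F_def diff_zero by (simp del: fact_Suc)
    have cancel: "1 / (real n + 1) * (a * (real n + 1) - d * (real n + 1)) = a - d" for a d
      by (simp add: field_simps)
    have "g 0 = 1 / (real n + 1) * ((real s + 2) * (real n + 1) - c)"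
      unfolding g_def F0 by (simp add: add_ac)
    also have "\<dots> = (real s + 2) - (real s + 1)\<^sup>2 / real s"
      unfolding c_def by (rule cancel)
    finally have "g 0 = (real s + 2) - (real s + 1)\<^sup>2 / real s" .
    then show ?thesis using s by (simp add: field_simps power2_eq_square)
  qed
  also have "g N = - (real s + 1) / real s *
    (\<Prod>i<s. ((real s + 1) * real N + 1 + real i) / ((real s + 2) * real N + 1 + real i))"
  proof -
    have nN: "n + 1 - N = (s + 1) * N" using n by simp
    have 1: "(real s + 2) * real (n + 1 - N) - c = - (real s + 1) / real s * (real n + 1)"
      using s unfolding nN c_def rn by (simp add: field_simps power2_eq_square)
    have 2: "fact (n + 1 - N + s) / fact (n + 1 - N) = (\<Prod>i<s. (real s + 1) * real N + 1 + real i)"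
      unfolding nN fact_add_prod by (simp add: algebra_simps)
    have "fact (n + s + 1) = (fact (n + 1 + s) :: real)" by (simp add: add_ac)
    also have "\<dots> = fact (n + 1) * (\<Prod>i<s. (real s + 2) * real N + 1 + real i)"
      unfolding fact_add_prod by (simp add: rn[symmetric] add_ac)
    finally have 3: "F * (real n + 1) = 1 / (\<Prod>i<s. (real s + 2) * real N + 1 + real i)"
      by (simp add: F_def add_ac)
    have "F * u * (v * (real n + 1)) = v * (u / w)" if "F * (real n + 1) = 1 / w" for u v w
    proof -
      have "F * u * (v * (real n + 1)) = v * u * (F * (real n + 1))" by (simp only: mult_ac)
      then show ?thesis by (simp only: that) simp
    qed
    from this[OF 3] show ?thesis unfolding g_def 1 2 prod_dividef .
  qed
  finally have "(\<Sum>k<N. ballot_prob s n k) = - 1 / real s - - (real s + 1) / real s *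
    (\<Prod>i<s. ((real s + 1) * real N + 1 + real i) / ((real s + 2) * real N + 1 + real i))" .
  moreover have "- 1 / real s - - (real s + 1) / real s * y = ((real s + 1) * y - 1) / real s" for y
    using s by (simp add: field_simps)
  ultimately show ?thesis by (simp only:)
qed

text \<open>
  For \<open>s = 0\<close> the second kind of term is \<open>(m - 1)! / m! = 1 / m\<close>, so that its sum is harmonic.
\<close>

lemma sum_ballot_prob_0:
  assumes n: "n + 1 = 2 * N"
  shows "(\<Sum>k<N. ballot_prob 0 n k) = 1 - (harm (2 * N) - harm N)"
proof -
  have rn: "real n + 1 = 2 * real N" using n by linarith
  have N: "N \<le> n" "N > 0" using n by auto
  have "ballot_prob 0 n k = 1 / real N - (harm (2 * N - k) - harm (2 * N - Suc k))"
    if kN: "k < N" for k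
  proof -
    have "k \<le> n" using kN N by linarith
    then obtain p where p: "n = k + p" using le_Suc_ex by blast
    have "2 * N - k = Suc p" "2 * N - Suc k = p" using n p by auto
    then have h: "harm (2 * N - k) - harm (2 * N - Suc k) = 1 / (real p + 1)"
      by (simp add: harm_Suc field_simps)
    have "ballot_prob 0 n k = (real n + 1 - 2 * real k) / ((real p + 1) * (real n + 1))"
    proof -
      have "fact (n + 1 - k) = (real p + 1) * fact p" "n - k = p" by (simp_all add: p)
      moreover have "fact (n + 0 + 1) = (real n + 1) * fact n" by simp
      ultimately show ?thesis unfolding ballot_prob_def by simp
    qed
    also have "real n + 1 - 2 * real k = 2 * (real p + 1) - (real n + 1)" by (simp add: p)
    also have "(2 * (real p + 1) - (real n + 1)) / ((real p + 1) * (real n + 1)) =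
        2 / (real n + 1) - 1 / (real p + 1)"
      by (subst diff_frac_eq) (simp_all add: mult.commute)
    finally show ?thesis using N by (simp add: h rn)
  qed
  then have "(\<Sum>k<N. ballot_prob 0 n k) =
      (\<Sum>k<N. 1 / real N - (harm (2 * N - k) - harm (2 * N - Suc k)))"
    by (intro sum.cong) auto
  also have "\<dots> = 1 - (\<Sum>k<N. harm (2 * N - k) - harm (2 * N - Suc k))"
    using N by (simp add: sum_subtractf)
  also have "(\<Sum>k<N. harm (2 * N - k) - harm (2 * N - Suc k)) = harm (2 * N) - (harm N :: real)"
    by (subst sum_lessThan_telescope') simp
  finally show ?thesis .
qed

section \<open>The probability of surviving forever\<close>

definition survival_limit :: "nat \<Rightarrow> real" where
  "survival_limit s = (if s = 0 then 1 - ln 2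
     else ((real s + 1) * ((real s + 1) / (real s + 2)) ^ s - 1) / real s)"

text \<open>
  For \<open>s = 0\<close> both \<open>harm (2 * N) - ln (2 * N)\<close> and \<open>harm N - ln N\<close> converge to the Euler-Mascheroni
  constant, so \<open>harm (2 * N) - harm N\<close> tends to \<open>ln 2\<close>. For \<open>s > 0\<close> the product has a fixed number of
  factors, each of which converges to \<open>(s + 1) / (s + 2)\<close>.
\<close>

lemma sum_ballot_prob_LIMSEQ:
  "(\<lambda>N. \<Sum>k<Suc N. ballot_prob s ((s + 2) * Suc N - 1) k) \<longlonglongrightarrow> survival_limit s"
proof (cases "s = 0")
  case True
  have e: "(\<lambda>N. harm N - ln (real N)) \<longlonglongrightarrow> euler_mascheroni"
    by (fact euler_mascheroni_LIMSEQ)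
  have "(\<lambda>N. harm (2 * N) - ln (real (2 * N))) \<longlonglongrightarrow> euler_mascheroni"
    using LIMSEQ_subseq_LIMSEQ[OF e, of "\<lambda>N. 2 * N"] by (simp add: strict_mono_def o_def)
  from tendsto_diff[OF this e]
  have "(\<lambda>N. (harm (2 * N) - harm N) - (ln (real (2 * N)) - ln (real N))) \<longlonglongrightarrow> 0"
    by (simp add: algebra_simps)
  from LIMSEQ_Suc[OF this]
  have "(\<lambda>N. (harm (2 * Suc N) - harm (Suc N)) - ln 2) \<longlonglongrightarrow> (0 :: real)"
    by (simp add: ln_mult del: of_nat_Suc mult_Suc_right)
  then have "(\<lambda>N. harm (2 * Suc N) - harm (Suc N)) \<longlonglongrightarrow> (ln 2 :: real)"
    by (simp only: LIM_zero_iff)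
  then have "(\<lambda>N. 1 - (harm (2 * Suc N) - harm (Suc N))) \<longlonglongrightarrow> 1 - (ln 2 :: real)"
    by (intro tendsto_intros)
  moreover have "(\<Sum>k<Suc N. ballot_prob s ((s + 2) * Suc N - 1) k) =
      1 - (harm (2 * Suc N) - harm (Suc N))" for N
    unfolding True by (rule sum_ballot_prob_0) simp
  ultimately show ?thesis by (simp add: survival_limit_def True)
next
  case False
  have "(\<lambda>N. ((real s + 1) * real N + 1 + real i) / ((real s + 2) * real N + 1 + real i))
      \<longlonglongrightarrow> (real s + 1) * inverse (real s + 2)" for i
    by real_asymp
  then have "(\<lambda>N. \<Prod>i<s. ((real s + 1) * real N + 1 + real i) / ((real s + 2) * real N + 1 + real i))
      \<longlonglongrightarrow> (\<Prod>i<s. (real s + 1) / (real s + 2))"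
    unfolding divide_inverse[of "real s + 1" "real s + 2"] by (intro tendsto_prod)
  note P = LIMSEQ_Suc[OF this]
  have "(\<lambda>N. ((real s + 1) * (\<Prod>i<s. ((real s + 1) * real (Suc N) + 1 + real i) /
      ((real s + 2) * real (Suc N) + 1 + real i)) - 1) / real s) \<longlonglongrightarrow>
      ((real s + 1) * (\<Prod>i<s. (real s + 1) / (real s + 2)) - 1) / real s"
    using False by (intro tendsto_divide tendsto_diff tendsto_mult tendsto_const P) simp
  moreover have "(\<Sum>k<Suc N. ballot_prob s ((s + 2) * Suc N - 1) k) =
    ((real s + 1) * (\<Prod>i<s. ((real s + 1) * real (Suc N) + 1 + real i) /
      ((real s + 2) * real (Suc N) + 1 + real i)) - 1) / real s" for N
    using False by (intro sum_ballot_prob) auto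
  ultimately show ?thesis using False by (simp add: survival_limit_def)
qed

text \<open>
  By continuity from above the survival probabilities converge to that of surviving forever, so it
  suffices to know them along the subsequence \<open>n = (s + 2) * (N + 1) - 1\<close>.
\<close>

lemma prob_survival_forever:
  assumes urn: "polya_urn M R 1 (Suc s)"
  shows "\<P>(\<omega> in M. \<forall>n. (s + 2) * R n \<omega> \<le> n + s + 2) = survival_limit s"
proof -
  interpret polya_urn M R 1 "Suc s" by (fact urn)
  note random_variable_R[measurable]
  have [measurable]: "Measurable.pred M (survival R s n)" for n
    unfolding survival_def by measurable
  let ?E = "\<lambda>n. {\<omega> \<in> space M. survival R s n \<omega>}"
  have "decseq ?E"
    by (intro decseq_SucI) (auto simp: survival_def)
  then have "(\<lambda>n. prob (?E n)) \<longlonglongrightarrow> prob (\<Inter>n. ?E n)"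
    by (intro finite_Lim_measure_decseq) auto
  moreover have "strict_mono (\<lambda>N. (s + 2) * Suc N - 1)"
    by (auto simp: strict_mono_Suc_iff)
  ultimately have "(\<lambda>N. prob (?E ((s + 2) * Suc N - 1))) \<longlonglongrightarrow> prob (\<Inter>n. ?E n)"
    by (auto dest: LIMSEQ_subseq_LIMSEQ simp: o_def)
  moreover have "prob (?E ((s + 2) * Suc N - 1)) = (\<Sum>k<Suc N. ballot_prob s ((s + 2) * Suc N - 1) k)" for N
    by (rule prob_survival[OF urn]) simp
  ultimately have "prob (\<Inter>n. ?E n) = survival_limit s"
    using sum_ballot_prob_LIMSEQ[of s] LIMSEQ_unique by auto
  moreover have "(\<Inter>n. ?E n) = {\<omega> \<in> space M. \<forall>n. (s + 2) * R n \<omega> \<le> n + s + 2}"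
    by (auto simp: survival_def)
  ultimately show ?thesis by simp
qed

section \<open>Supremum and infimum of the fractions\<close>

lemma (in polya_urn) urn_S_le_iff:
  assumes "\<omega> \<in> space M"
  shows "urn_S R r b \<omega> \<le> x \<longleftrightarrow> (\<forall>n. urn_Z R r b n \<omega> \<le> x)"
  unfolding urn_S_def
  by (subst cSUP_le_iff) (auto intro!: bdd_aboveI2[of _ _ 1] urn_Z_bounds assms)

lemma (in polya_urn) le_urn_I_iff:
  assumes "\<omega> \<in> space M"
  shows "x \<le> urn_I R r b \<omega> \<longleftrightarrow> (\<forall>n. x \<le> urn_Z R r b n \<omega>)"
  unfolding urn_I_def
  by (subst le_cINF_iff) (auto intro!: bdd_belowI2[of _ 0] urn_Z_bounds assms)

lemma (in polya_urn) urn_I_swap_colours: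
  assumes "\<omega> \<in> space M"
  shows "1 - x \<le> urn_I R r b \<omega> \<longleftrightarrow> urn_S (\<lambda>n \<omega>. n + r + b - R n \<omega>) b r \<omega> \<le> x"
proof -
  have Z: "urn_Z (\<lambda>n \<omega>. n + r + b - R n \<omega>) b r n \<omega> = 1 - urn_Z R r b n \<omega>" for n
    using R_bounds(2)[OF assms, of n] red_pos
    by (simp add: urn_Z_def of_nat_diff field_simps)
  show ?thesis
    unfolding le_urn_I_iff[OF assms] polya_urn.urn_S_le_iff[OF swap_colours assms] Z
    by (intro iff_allI) linarith
qed

lemma prob_urn_S:
  assumes urn: "polya_urn M R 1 (t - 1)" and t: "t \<ge> 2"
  shows "\<P>(\<omega> in M. urn_S R 1 (t - 1) \<omega> \<le> 1 / real t) = survival_limit (t - 2)"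
proof -
  obtain s where s: "t = s + 2" using t le_Suc_ex by (metis add.commute)
  interpret polya_urn M R 1 "Suc s" using urn by (simp add: s)
  have "urn_Z R 1 (Suc s) n \<omega> \<le> 1 / real t \<longleftrightarrow> (s + 2) * R n \<omega> \<le> n + s + 2" for n \<omega>
  proof -
    have "urn_Z R 1 (Suc s) n \<omega> \<le> 1 / real t \<longleftrightarrow> real ((s + 2) * R n \<omega>) \<le> real (n + s + 2)"
      by (simp add: urn_Z_def s field_simps)
    then show ?thesis by (simp only: of_nat_le_iff)
  qed
  then have "{\<omega> \<in> space M. urn_S R 1 (Suc s) \<omega> \<le> 1 / real t} =
      {\<omega> \<in> space M. \<forall>n. (s + 2) * R n \<omega> \<le> n + s + 2}"
    using urn_S_le_iff by auto
  then show ?thesis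
    using prob_survival_forever[of M R s] urn by (simp add: s)
qed

lemma prob_urn_I:
  assumes urn: "polya_urn M R (t - 1) 1" and t: "t \<ge> 2"
  shows "\<P>(\<omega> in M. urn_I R (t - 1) 1 \<omega> \<ge> (real t - 1) / real t) = survival_limit (t - 2)"
proof -
  interpret polya_urn M R "t - 1" 1 by (fact urn)
  have "(real t - 1) / real t = 1 - 1 / real t" using t by (simp add: field_simps)
  then have "{\<omega> \<in> space M. urn_I R (t - 1) 1 \<omega> \<ge> (real t - 1) / real t} =
      {\<omega> \<in> space M. urn_S (\<lambda>n \<omega>. n + (t - 1) + 1 - R n \<omega>) 1 (t - 1) \<omega> \<le> 1 / real t}"
    using urn_I_swap_colours by auto
  then show ?thesis using prob_urn_S[OF swap_colours t] by simp
qed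

section \<open>The value and its limit\<close>

lemma survival_limit_eq:
  assumes "t \<ge> 2"
  shows "survival_limit (t - 2) = (if t = 2 then 1 - ln 2
    else ((real t - 1) * (1 - 1 / real t) ^ (t - 2) - 1) / (real t - 2))"
proof -
  have "1 - 1 / real t = (real t - 1) / real t" using assms by (simp add: field_simps)
  then show ?thesis using assms by (auto simp: survival_limit_def of_nat_diff)
qed

text \<open>
  The exponent \<open>t - 2\<close> is written as a real power first, since then the limit is one of a concrete
  real function.
\<close>

lemma survival_limit_LIMSEQ: "(\<lambda>t. survival_limit (t - 2)) \<longlonglongrightarrow> exp (-1)"
proof (rule Lim_transform_eventually)
  show "(\<lambda>t::nat. ((real t - 1) * (1 - 1 / real t) powr (real t - 2) - 1) / (real t - 2))
      \<longlonglongrightarrow> exp (-1)"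
    by real_asymp
  show "\<forall>\<^sub>F t::nat in sequentially.
      ((real t - 1) * (1 - 1 / real t) powr (real t - 2) - 1) / (real t - 2) = survival_limit (t - 2)"
    using eventually_gt_at_top[of 2]
  proof eventually_elim
    case (elim t)
    then have "(1 - 1 / real t) powr (real t - 2) = (1 - 1 / real t) ^ (t - 2)"
      by (subst powr_realpow[symmetric]) (auto simp: of_nat_diff)
    with elim show ?case by (simp add: survival_limit_eq)
  qed
qed

theorem proposition5p4:
  fixes M :: "nat \<Rightarrow> 'a measure" and R :: "nat \<Rightarrow> nat \<Rightarrow> 'a \<Rightarrow> nat"
    and N :: "nat \<Rightarrow> 'b measure" and Q :: "nat \<Rightarrow> nat \<Rightarrow> 'b \<Rightarrow> nat"
  assumes majority_red: "\<And>t. t \<ge> 2 \<Longrightarrow> polya_urn (M t) (R t) (t - 1) 1"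
    and single_red: "\<And>t. t \<ge> 2 \<Longrightarrow> polya_urn (N t) (Q t) 1 (t - 1)"
  shows "(\<forall>t\<ge>2.
            \<P>(\<omega> in M t. urn_I (R t) (t - 1) 1 \<omega> \<ge> (real t - 1) / real t) =
            \<P>(\<omega> in N t. urn_S (Q t) 1 (t - 1) \<omega> \<le> 1 / real t) \<and>
            \<P>(\<omega> in N t. urn_S (Q t) 1 (t - 1) \<omega> \<le> 1 / real t) =
              (if t = 2 then 1 - ln 2
               else ((real t - 1) * (1 - 1 / real t) ^ (t - 2) - 1) / (real t - 2))) \<and>
         (\<lambda>t. \<P>(\<omega> in M t. urn_I (R t) (t - 1) 1 \<omega> \<ge> (real t - 1) / real t))
           \<longlonglongrightarrow> exp (-1)"
proof (intro conjI allI impI)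
  fix t :: nat assume t: "t \<ge> 2"
  note S = prob_urn_S[OF single_red[OF t] t] and I = prob_urn_I[OF majority_red[OF t] t]
  show "\<P>(\<omega> in M t. urn_I (R t) (t - 1) 1 \<omega> \<ge> (real t - 1) / real t) =
      \<P>(\<omega> in N t. urn_S (Q t) 1 (t - 1) \<omega> \<le> 1 / real t)"
    by (simp only: S I)
  show "\<P>(\<omega> in N t. urn_S (Q t) 1 (t - 1) \<omega> \<le> 1 / real t) =
      (if t = 2 then 1 - ln 2
       else ((real t - 1) * (1 - 1 / real t) ^ (t - 2) - 1) / (real t - 2))"
    by (simp only: S survival_limit_eq[OF t])
next
  have "\<forall>\<^sub>F t in sequentially.
      survival_limit (t - 2) = \<P>(\<omega> in M t. urn_I (R t) (t - 1) 1 \<omega> \<ge> (real t - 1) / real t)"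
    using eventually_ge_at_top[of 2] by eventually_elim (simp only: prob_urn_I majority_red)
  with survival_limit_LIMSEQ
  show "(\<lambda>t. \<P>(\<omega> in M t. urn_I (R t) (t - 1) 1 \<omega> \<ge> (real t - 1) / real t)) \<longlonglongrightarrow> exp (-1)"
    by (rule Lim_transform_eventually)
qed

end
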